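(* For every integer $k\geq 2$ there is a constant $C_k>0$, depending only on $k$, such that the following holds. For every $\epsilon\in(0,1)$ and every prime $p$ there is $n_0=n_0(k,\epsilon,p)$ such that for all $n\geq n_0$: if $G:=\mathbb{F}_p^n$ and $A\subseteq G$ is $k$-stable, then there is a subspace $H\leqslant G$ of codimension at most $C_k\,\epsilon^{-C_k}$ such that for every $g\in G$, either $|(A-g)\cap H|\leq \epsilon|H|$ or $|H\setminus(A-g)|\leq \epsilon|H|$.
   Context: Let $G$ be an abelian group, $A\subseteq G$ and $k\geq 1$ an integer. The set $A$ has the $k$-order property if there exist $a_1,\ldots,a_k,b_1,\ldots,b_k\in G$ such that for all $1\leq i,j\leq k$, $a_i+b_j\in A$ if and only if $i\leq j$. The set $A$ is $k$-stable if it does not have the $k$-order property. For $g\in G$, $A-g:=\{a-g: a\in A\}$. The bound $O_k(\epsilon^{-O_k(1)})$ on the codimension is written here as $C_k\epsilon^{-C_k}$ with $C_k$ depending only on $k$. *)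

theory Defs
  imports "HOL-Number_Theory.Residues" "Jordan_Normal_Form.Missing_VectorSpace"
begin

text \<open>The ambient group is the additive group of a \<open>ring\<close> record, so that the definitions apply
  directly to a vector space given as a \<open>module\<close> record.\<close>

definition k_order_property :: "('a, 'm) ring_scheme \<Rightarrow> nat \<Rightarrow> 'a set \<Rightarrow> bool" where
  "k_order_property G k A \<longleftrightarrow>
     (\<exists>a b :: nat \<Rightarrow> 'a. a \<in> {1..k} \<rightarrow> carrier G \<and> b \<in> {1..k} \<rightarrow> carrier G \<and>
        (\<forall>i\<in>{1..k}. \<forall>j\<in>{1..k}. a i \<oplus>\<^bsub>G\<^esub> b j \<in> A \<longleftrightarrow> i \<le> j))"

definition k_stable :: "('a, 'm) ring_scheme \<Rightarrow> nat \<Rightarrow> 'a set \<Rightarrow> bool" where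
  "k_stable G k A \<longleftrightarrow> \<not> k_order_property G k A"

definition translate :: "('a, 'm) ring_scheme \<Rightarrow> 'a set \<Rightarrow> 'a \<Rightarrow> 'a set" where
  "translate G A g = {a \<ominus>\<^bsub>G\<^esub> g | a. a \<in> A}"

text \<open>\<open>F\<^sub>p^n\<close> is the space of functions from \<open>{..<n}\<close> to the residue field, extended by
  \<open>undefined\<close> outside \<open>{..<n}\<close>. The dimension and the prime are terms rather than types
  because the theorem quantifies over both of them inside the formula.\<close>

abbreviation Fp :: "nat \<Rightarrow> int ring" where
  "Fp p \<equiv> residue_ring (int p)"

abbreviation Fp_space :: "nat \<Rightarrow> nat \<Rightarrow> (int, nat \<Rightarrow> int) module" where
  "Fp_space p n \<equiv> ring.func_space (Fp p) {..<n}"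

text \<open>Meaningful for a subspace \<open>H\<close> of a finite-dimensional space \<open>V\<close>.\<close>

definition codim :: "('a, 'c) ring_scheme \<Rightarrow> ('a, 'b, 'd) module_scheme \<Rightarrow> 'b set \<Rightarrow> int" where
  "codim K V H = int (vectorspace.dim K V) - int (vectorspace.dim K (V\<lparr>carrier := H\<rparr>))"

lemma vectorspace_Fp_space:
  assumes "prime p"
  shows "vectorspace (Fp p) (Fp_space p n)"
proof -
  interpret residues_prime p "Fp p"
    by unfold_locales (use assms in simp_all)
  show ?thesis
    by (intro vectorspace.intro func_space_is_module is_field)
qed

end

theory Submission
  imports Defs
begin

text \<open>The proof uses no Fourier analysis and gives a subgroup whose index, and not only whose
codimension, is polynomial in \<open>1/\<epsilon>\<close>.

Write \<open>G\<close> for the group, \<open>B - y\<close> for the translate \<open>{b. b + y \<in> B}\<close>, and call a set of the form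
\<open>{x. g + x \<in> A}\<close> a translate of \<open>A\<close>. Stability bounds the height of a full binary tree whose inner
nodes ask "is \<open>x + b \<in> A\<close>?" and all of whose branches are realised by some \<open>b\<close>: a tree of height
\<open>2^(k+1) - 2\<close> contains a \<open>k\<close>-order (\<open>has_tree_imp_ladder\<close>, a lemma of Hodges). So if one starts
from \<open>G\<close> and keeps splitting the current set by some translate of \<open>A\<close> for as long as both parts are
a \<open>\<delta>\<close>-proportion of it, a good choice of parts must end after at most \<open>d = 2^(k+1) - 2\<close> steps.
What is left is a set \<open>B\<close> which every translate of \<open>A\<close> contains or avoids up to \<open>\<delta>|B|\<close> elements
(\<open>exists_good_cell\<close>).

The point is that \<open>B\<close> is itself an intersection of at most \<open>d\<close> translates of \<open>A\<close> and of its
complement. Hence a translate \<open>B - y\<close> also almost contains or almost avoids \<open>B\<close>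
(\<open>good_cell_dichotomy\<close>), and the \<open>y\<close> of the first kind form a subgroup \<open>H\<close>, because the errors of
two of them add up to something far from avoidance (\<open>almost_period_add_closed\<close>). If moreover \<open>\<delta>\<close>
is much smaller than the density of \<open>B\<close> in \<open>G\<close>, then counting pairs \<open>(b, b + y)\<close> in \<open>B \<times> B\<close> shows
that almost all of them have \<open>y \<in> H\<close>, which forces \<open>B\<close> to be almost equal to a coset of \<open>H\<close>
(\<open>indivisible_set_near_coset\<close>). Being almost contained in or almost disjoint from each translate
of \<open>A\<close> then passes from \<open>B\<close> to that coset, hence to \<open>H\<close>, and this is the assertion
(\<open>no_tree_imp_good_subgroup\<close>).

The smallness of \<open>\<delta>\<close> relative to the density is arranged by letting the threshold decrease along
the splitting: with \<open>\<kappa>\<close> of order \<open>\<epsilon>/d\<close>, a set reached after \<open>j\<close> splittings has density at least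
\<open>\<kappa>^(2^j - 1)\<close>, and is tested with threshold \<open>\<kappa>^(2^j)\<close>. So \<open>H\<close> has index at most \<open>\<kappa>^(- 2^d)\<close>. Over
a field with at least two elements the codimension is at most the binary logarithm of the index,
which is why the bound does not depend on \<open>p\<close>.\<close>

section \<open>Binary trees and the order property\<close>

text \<open>The largest \<open>n\<close> for which such a tree exists is the Littlestone dimension of the family of the sets
\<open>{x \<in> X. R x b}\<close> for \<open>b \<in> B\<close>, also known as Shelah's 2-rank. The height-0 case asks that every branch
be realised by an element of \<open>B\<close>.\<close>
fun has_tree :: "('a \<Rightarrow> 'b \<Rightarrow> bool) \<Rightarrow> nat \<Rightarrow> 'a set \<Rightarrow> 'b set \<Rightarrow> bool" where
  "has_tree R 0 X B \<longleftrightarrow> B \<noteq> {}"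
| "has_tree R (Suc n) X B \<longleftrightarrow>
     (\<exists>x\<in>X. has_tree R n X {b \<in> B. R x b} \<and> has_tree R n X {b \<in> B. \<not> R x b})"

lemma has_tree_mono:
  "has_tree R n X B \<Longrightarrow> X \<subseteq> X' \<Longrightarrow> B \<subseteq> B' \<Longrightarrow> has_tree R n X' B'"
proof (induction n arbitrary: B B')
  case 0
  then show ?case by auto
next
  case (Suc n)
  then obtain x where x: "x \<in> X" "has_tree R n X {b \<in> B. R x b}"
      "has_tree R n X {b \<in> B. \<not> R x b}"
    by auto
  have "has_tree R n X' {b \<in> B'. R x b}"
    by (rule Suc.IH[OF x(2)]) (use Suc.prems in auto)
  moreover have "has_tree R n X' {b \<in> B'. \<not> R x b}"
    by (rule Suc.IH[OF x(3)]) (use Suc.prems in auto)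
  ultimately show ?case using x(1) Suc.prems by auto
qed

lemma has_tree_nonempty: "has_tree R n X B \<Longrightarrow> B \<noteq> {}"
proof (induction n arbitrary: B)
  case (Suc n)
  then show ?case by fastforce
qed simp

text \<open>A Ramsey property of trees: if the possible node labels get two colours, then a high tree contains
a sub-tree in one of them. The root extends the sub-trees of its own colour that are found on both
sides; if some side offers the other colour instead, that one is already as high as needed.\<close>

lemma has_tree_split_nodes:
  assumes "has_tree R (m + n) X B" and "X \<subseteq> Y \<union> Z"
  shows "has_tree R m Y B \<or> has_tree R n Z B"
  using assms(1)
proof (induction N \<equiv> "m + n" arbitrary: m n B)
  case 0
  then show ?case by simp
next
  case (Suc N)
  show ?case
  proof (cases "m = 0 \<or> n = 0")
    case True
    then show ?thesis using has_tree_nonempty[OF Suc.prems] by auto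
  next
    case False
    then obtain m' n' where mn: "m = Suc m'" "n = Suc n'"
      by (metis not0_implies_Suc)
    with Suc.hyps(2) have N: "N = m' + n" "N = m + n'" by auto
    note IH = Suc.hyps(1)[OF N(1)] Suc.hyps(1)[OF N(2)]
    from Suc.prems Suc.hyps(2)[symmetric] obtain x where x: "x \<in> X"
        "has_tree R N X {b \<in> B. R x b}" "has_tree R N X {b \<in> B. \<not> R x b}"
      by auto
    show ?thesis
    proof (cases "x \<in> Y")
      case True
      have "has_tree R m' Y {b \<in> B. R x b} \<or> has_tree R n Z {b \<in> B. R x b}"
        "has_tree R m' Y {b \<in> B. \<not> R x b} \<or> has_tree R n Z {b \<in> B. \<not> R x b}"
        using x IH(1) N(1) by metis+
      with True mn show ?thesis
        by (auto intro: has_tree_mono[where X = Z])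
    next
      case False
      with x(1) assms(2) have "x \<in> Z" by auto
      have "has_tree R m Y {b \<in> B. R x b} \<or> has_tree R n' Z {b \<in> B. R x b}"
        "has_tree R m Y {b \<in> B. \<not> R x b} \<or> has_tree R n' Z {b \<in> B. \<not> R x b}"
        using x IH(2) N(2) by metis+
      with \<open>x \<in> Z\<close> mn show ?thesis
        by (auto intro: has_tree_mono[where X = Y])
    qed
  qed
qed

text \<open>Hodges' lemma. Fix one branch \<open>b0\<close> and colour the labels \<open>x\<close> by the truth of \<open>R x b0\<close>. A sub-tree
whose labels all satisfy \<open>R x b0\<close> supplies its root \<open>a0\<close> and, below it, the side on which \<open>R a0\<close>
fails: whatever ladder is found there can be continued by \<open>a0, b0\<close> at its end. Dually, a sub-tree
of labels with \<open>\<not> R x b0\<close> supplies a root \<open>a0\<close> such that \<open>b0, a0\<close> can be put in front of a ladder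
found where \<open>R a0\<close> holds. Starting the \<open>b\<close>-sequence at index \<open>0\<close>, one before the \<open>a\<close>-sequence, makes
both extensions possible.\<close>

lemma has_tree_imp_ladder:
  "has_tree R (2 ^ (k + 1) - 2) X B \<Longrightarrow>
    \<exists>a b. a \<in> {1..k} \<rightarrow> X \<and> b \<in> {..k} \<rightarrow> B \<and> (\<forall>i\<in>{1..k}. \<forall>j\<le>k. R (a i) (b j) \<longleftrightarrow> i \<le> j)"
proof (induction k arbitrary: X B)
  case 0
  then obtain b where "b \<in> B" by auto
  then show ?case by (intro exI[of _ "\<lambda>_. b"] exI[of _ undefined]) auto
next
  case (Suc k)
  define h :: nat where "h = 2 ^ (k + 1) - 2"
  have "2 ^ (Suc k + 1) - 2 = Suc h + Suc h"
    unfolding h_def by (cases "2 ^ k :: nat") auto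
  with Suc.prems have tree: "has_tree R (Suc h + Suc h) X B" by simp
  then obtain b0 where b0: "b0 \<in> B" using has_tree_nonempty by blast
  define Y where "Y = {x \<in> X. R x b0}"
  define Z where "Z = {x \<in> X. \<not> R x b0}"
  have "has_tree R (Suc h) Y B \<or> has_tree R (Suc h) Z B"
    by (rule has_tree_split_nodes[OF tree]) (auto simp: Y_def Z_def)
  then show ?case
  proof
    assume "has_tree R (Suc h) Y B"
    then obtain a0 where a0: "a0 \<in> Y" "has_tree R h Y {b \<in> B. \<not> R a0 b}"
      by auto
    from Suc.IH[OF a0(2)[unfolded h_def]] obtain a b where ab: "a \<in> {1..k} \<rightarrow> Y"
        "b \<in> {..k} \<rightarrow> {b \<in> B. \<not> R a0 b}"
        "\<And>i j. i \<in> {1..k} \<Longrightarrow> j \<le> k \<Longrightarrow> R (a i) (b j) \<longleftrightarrow> i \<le> j"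
      by auto
    have "R ((a(Suc k := a0)) i) ((b(Suc k := b0)) j) \<longleftrightarrow> i \<le> j"
      if "i \<in> {1..Suc k}" "j \<le> Suc k" for i j
    proof (cases "i = Suc k"; cases "j = Suc k")
      assume "i \<noteq> Suc k" "j = Suc k"
      moreover from this that have "a i \<in> Y" using ab(1) by auto
      ultimately show ?thesis using that by (auto simp: Y_def)
    qed (use that ab a0 in \<open>auto simp: Y_def Pi_iff\<close>)
    then show ?case
      by (intro exI[of _ "a(Suc k := a0)"] exI[of _ "b(Suc k := b0)"])
         (use ab a0 b0 in \<open>auto simp: Y_def Pi_iff le_Suc_eq\<close>)
  next
    assume "has_tree R (Suc h) Z B"
    then obtain a0 where a0: "a0 \<in> Z" "has_tree R h Z {b \<in> B. R a0 b}"
      by auto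
    from Suc.IH[OF a0(2)[unfolded h_def]] obtain a b where ab: "a \<in> {1..k} \<rightarrow> Z"
        "b \<in> {..k} \<rightarrow> {b \<in> B. R a0 b}"
        "\<And>i j. i \<in> {1..k} \<Longrightarrow> j \<le> k \<Longrightarrow> R (a i) (b j) \<longleftrightarrow> i \<le> j"
      by auto
    define a' where "a' i = (if i = 1 then a0 else a (i - 1))" for i
    define b' where "b' j = (if j = 0 then b0 else b (j - 1))" for j
    have a': "i = 1 \<and> a' i = a0 \<or> i \<noteq> 1 \<and> i - 1 \<in> {1..k} \<and> a' i = a (i - 1) \<and> a' i \<in> Z"
      if "i \<in> {1..Suc k}" for i
    proof (cases "i = 1")
      case False
      with that have "i - 1 \<in> {1..k}" by auto
      with False ab(1) show ?thesis by (auto simp: a'_def)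
    qed (simp add: a'_def)
    have b': "j = 0 \<and> b' j = b0 \<or> j \<noteq> 0 \<and> j - 1 \<le> k \<and> b' j = b (j - 1) \<and> b' j \<in> {b \<in> B. R a0 b}"
      if "j \<le> Suc k" for j
      using that ab(2) by (auto simp: b'_def)
    have "R (a' i) (b' j) \<longleftrightarrow> i \<le> j" if "i \<in> {1..Suc k}" "j \<le> Suc k" for i j
      using a'[OF that(1)] b'[OF that(2)] a0(1) ab(3)[of "i - 1" "j - 1"] that
      by (auto simp: Z_def)
    moreover have "a' \<in> {1..Suc k} \<rightarrow> X"
      using a' a0(1) by (fastforce simp: Z_def)
    moreover have "b' \<in> {..Suc k} \<rightarrow> B"
      using b' b0 by (fastforce simp: Z_def)
    ultimately show ?case by blast
  qed
qed

lemma k_stable_imp_no_tree: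
  assumes "k_stable G k A"
  shows "\<not> has_tree (\<lambda>x b. x \<oplus>\<^bsub>G\<^esub> b \<in> A) (2 ^ (k + 1) - 2) (carrier G) (carrier G)"
proof
  assume "has_tree (\<lambda>x b. x \<oplus>\<^bsub>G\<^esub> b \<in> A) (2 ^ (k + 1) - 2) (carrier G) (carrier G)"
  from has_tree_imp_ladder[OF this] obtain a b where
    "a \<in> {1..k} \<rightarrow> carrier G" "b \<in> {..k} \<rightarrow> carrier G"
    "\<forall>i\<in>{1..k}. \<forall>j\<le>k. a i \<oplus>\<^bsub>G\<^esub> b j \<in> A \<longleftrightarrow> i \<le> j"
    by blast
  then have "k_order_property G k A"
    unfolding k_order_property_def by (intro exI[of _ a] exI[of _ b]) auto
  with assms show False by (simp add: k_stable_def)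
qed

section \<open>Indivisible cells\<close>

definition cell :: "('a \<Rightarrow> 'b \<Rightarrow> bool) \<Rightarrow> 'b set \<Rightarrow> ('a \<times> bool) list \<Rightarrow> 'b set" where
  "cell R B L = {b \<in> B. \<forall>(x, s)\<in>set L. R x b = s}"

lemma cell_subset: "cell R B L \<subseteq> B"
  by (auto simp: cell_def)

text \<open>As long as some \<open>x\<close> cuts the cell into two substantial parts, pass to a part that carries no tree
of the next smaller height. After \<open>n\<close> passages the cell carries no tree of height \<open>0\<close>, so it is
empty, and an empty cell passes the test. The exponents encode \<open>\<beta>(0) = 1\<close> and \<open>\<beta>(l+1) = \<beta>(l) * (\<kappa> * \<beta>(l))\<close>, that is
\<open>\<beta>(l) = \<kappa>^(2^l - 1)\<close>: a cell given by \<open>l\<close> conditions has density at least \<open>\<beta>(l)\<close> and is tested with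
threshold \<open>\<kappa> * \<beta>(l) = \<kappa>^(2^l)\<close>, which is smaller than its density by the factor \<open>\<kappa>\<close>.\<close>

lemma exists_good_cell:
  fixes \<kappa> :: real
  assumes "finite B" and "0 < \<kappa>"
    and "\<not> has_tree R n X (cell R B L)" and "fst ` set L \<subseteq> X"
    and "\<kappa> ^ (2 ^ length L - 1) * card B \<le> card (cell R B L)"
  shows "\<exists>L'. length L' \<le> length L + n \<and> fst ` set L' \<subseteq> X \<and>
           \<kappa> ^ (2 ^ length L' - 1) * card B \<le> card (cell R B L') \<and>
           (\<forall>x\<in>X. card {b \<in> cell R B L'. R x b} \<le> \<kappa> ^ (2 ^ length L') * card (cell R B L') \<or>
                  card {b \<in> cell R B L'. \<not> R x b} \<le> \<kappa> ^ (2 ^ length L') * card (cell R B L'))"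
  using assms(3-)
proof (induction n arbitrary: L)
  case 0
  then have "cell R B L = {}" by simp
  with 0 show ?case by (intro exI[of _ L]) auto
next
  case (Suc n)
  let ?C = "cell R B L" and ?\<delta> = "\<kappa> ^ (2 ^ length L)"
  show ?case
  proof (cases "\<forall>x\<in>X. card {b \<in> ?C. R x b} \<le> ?\<delta> * card ?C \<or>
                       card {b \<in> ?C. \<not> R x b} \<le> ?\<delta> * card ?C")
    case True
    with Suc.prems show ?thesis by (intro exI[of _ L]) auto
  next
    case False
    then obtain x where x: "x \<in> X" and
      big: "?\<delta> * card ?C \<le> card {b \<in> ?C. R x b}" "?\<delta> * card ?C \<le> card {b \<in> ?C. \<not> R x b}"
      by force
    have split: "cell R B ((x, s) # L) = {b \<in> ?C. R x b = s}" for s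
      by (auto simp: cell_def)
    from Suc.prems(1) x have "\<not> has_tree R n X (cell R B ((x, True) # L)) \<or>
        \<not> has_tree R n X (cell R B ((x, False) # L))"
      unfolding split by auto
    then obtain s where s: "\<not> has_tree R n X (cell R B ((x, s) # L))" by blast
    have exponent: "2 ^ length ((x, s) # L) - 1 = 2 ^ length L + (2 ^ length L - 1 :: nat)"
      using one_le_power[of "2::nat" "length L"] by simp
    have "\<kappa> ^ (2 ^ length ((x, s) # L) - 1) * card B
        = ?\<delta> * (\<kappa> ^ (2 ^ length L - 1) * card B)"
      unfolding exponent power_add by (rule mult.assoc)
    also have "\<dots> \<le> ?\<delta> * card ?C"
      using Suc.prems(3) assms(2) by (intro mult_left_mono) auto
    also have "\<dots> \<le> card (cell R B ((x, s) # L))"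
      using big unfolding split by (cases s) auto
    finally have "\<kappa> ^ (2 ^ length ((x, s) # L) - 1) * card B \<le> card (cell R B ((x, s) # L))" .
    from Suc.IH[OF s _ this] x Suc.prems(2) show ?thesis by auto
  qed
qed

section \<open>Almost-periods of an indivisible set\<close>

context abelian_group
begin

definition almost_period :: "'a set \<Rightarrow> real \<Rightarrow> 'a set" where
  "almost_period B \<tau> = {y \<in> carrier G. real (card {b \<in> B. b \<oplus> y \<notin> B}) \<le> \<tau> * real (card B)}"

lemma card_shift_preimage:
  assumes "B \<subseteq> carrier G" and "b \<in> carrier G"
  shows "card {y \<in> carrier G. b \<oplus> y \<in> B} = card B"
proof (rule bij_betw_same_card[of "\<lambda>y. b \<oplus> y"])
  show "bij_betw (\<lambda>y. b \<oplus> y) {y \<in> carrier G. b \<oplus> y \<in> B} B"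
    by (rule bij_betw_byWitness[where f' = "\<lambda>z. z \<ominus> b"])
       (use assms in \<open>auto simp: minus_eq a_ac r_neg l_neg r_neg1 r_neg2 subset_iff\<close>)
qed

text \<open>If \<open>y\<close> and \<open>z\<close> each move at most a \<open>\<tau>\<close>-proportion of \<open>B\<close> out of \<open>B\<close>, then \<open>y \<oplus> z\<close> moves at most a
\<open>2 * \<tau>\<close>-proportion out. That is too little for the first alternative of the dichotomy, and the
second one improves \<open>2 * \<tau>\<close> back to \<open>\<tau>\<close>.\<close>

lemma almost_period_add_closed:
  fixes \<delta> \<tau> :: real
  assumes "finite B" "B \<subseteq> carrier G" "B \<noteq> {}" and "\<delta> + 2 * \<tau> < 1"
    and dichotomy: "\<And>y. y \<in> carrier G \<Longrightarrow> card {b \<in> B. b \<oplus> y \<in> B} \<le> \<delta> * card B \<or>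
                           card {b \<in> B. b \<oplus> y \<notin> B} \<le> \<tau> * card B"
    and "y \<in> almost_period B \<tau>" "z \<in> almost_period B \<tau>"
  shows "y \<oplus> z \<in> almost_period B \<tau>"
proof -
  from assms have yz: "y \<in> carrier G" "z \<in> carrier G"
    "card {b \<in> B. b \<oplus> y \<notin> B} \<le> \<tau> * card B" "card {b \<in> B. b \<oplus> z \<notin> B} \<le> \<tau> * card B"
    by (auto simp: almost_period_def)
  (* An element that leaves B under y + z leaves it in the first step, or is carried by y to an
     element that leaves it under z. *)
  let ?U = "{b \<in> B. b \<oplus> y \<in> B \<and> b \<oplus> y \<oplus> z \<notin> B}"
  have "card ?U = card ((\<lambda>b. b \<oplus> y) ` ?U)"
    using assms(2) yz by (intro card_image[symmetric] inj_onI) (auto simp: subset_iff)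
  also have "\<dots> \<le> card {b \<in> B. b \<oplus> z \<notin> B}"
    using assms(1) by (intro card_mono) auto
  finally have U: "card ?U \<le> card {b \<in> B. b \<oplus> z \<notin> B}" .
  have "card {b \<in> B. b \<oplus> (y \<oplus> z) \<notin> B} \<le> card ({b \<in> B. b \<oplus> y \<notin> B} \<union> ?U)"
    using assms(1,2) yz by (intro card_mono) (auto simp: a_assoc subset_iff)
  also have "\<dots> \<le> card {b \<in> B. b \<oplus> y \<notin> B} + card ?U"
    by (rule card_Un_le)
  finally have "card {b \<in> B. b \<oplus> (y \<oplus> z) \<notin> B} \<le> 2 * \<tau> * card B"
    using U yz(3,4) by linarith
  moreover have "card {b \<in> B. b \<oplus> (y \<oplus> z) \<in> B} + card {b \<in> B. b \<oplus> (y \<oplus> z) \<notin> B} = card B"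
    using assms(1) by (subst card_Un_disjoint[symmetric]) (auto intro!: arg_cong[where f = card])
  ultimately have "(1 - 2 * \<tau>) * card B \<le> card {b \<in> B. b \<oplus> (y \<oplus> z) \<in> B}"
    by (simp add: algebra_simps)
  moreover have "\<delta> * card B < (1 - 2 * \<tau>) * card B"
    using assms(1,3,4) by (intro mult_strict_right_mono) (auto simp: card_gt_0_iff)
  ultimately show ?thesis
    using dichotomy[of "y \<oplus> z"] yz by (auto simp: almost_period_def)
qed

text \<open>Together the two conclusions say that \<open>B\<close> is close to the coset \<open>c \<oplus> H\<close>: the second one puts most
of \<open>B\<close> into it, the first one says that the coset has little room for anything else. Both come
from counting the pairs \<open>(b, b \<oplus> y)\<close> in \<open>B \<times> B\<close> by their difference \<open>y\<close>. There are \<open>|B|\<^sup>2\<close> of them;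
each \<open>y \<in> H\<close> accounts for at least \<open>(1 - \<tau>)|B|\<close>, while all \<open>y \<notin> H\<close> together account for at most
\<open>\<delta>|B||G| \<le> \<kappa>|B|\<^sup>2\<close>.\<close>

lemma indivisible_set_near_coset:
  fixes \<delta> \<tau> \<kappa> :: real
  assumes "finite (carrier G)" "B \<subseteq> carrier G" "B \<noteq> {}"
    and "\<delta> * card (carrier G) \<le> \<kappa> * card B" and "0 \<le> \<delta>"
    and dichotomy: "\<And>y. y \<in> carrier G \<Longrightarrow> card {b \<in> B. b \<oplus> y \<in> B} \<le> \<delta> * card B \<or>
                           card {b \<in> B. b \<oplus> y \<notin> B} \<le> \<tau> * card B"
  defines "H \<equiv> almost_period B \<tau>"
  shows "(1 - \<tau>) * card H \<le> card B"
    and "\<exists>c\<in>B. (1 - \<kappa>) * card B \<le> card {h \<in> H. c \<oplus> h \<in> B}"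
proof -
  have fin: "finite B" "finite H"
    using assms(1,2) by (auto simp: H_def almost_period_def intro: finite_subset)
  have cardB: "real (card B) > 0" using fin assms(3) by (simp add: card_gt_0_iff)
  define ret where "ret y = card {b \<in> B. b \<oplus> y \<in> B}" for y
  have ret_compl: "ret y + card {b \<in> B. b \<oplus> y \<notin> B} = card B" for y
    unfolding ret_def using fin
    by (subst card_Un_disjoint[symmetric]) (auto intro!: arg_cong[where f = card])
  have count: "(\<Sum>y\<in>Y. ret y) = (\<Sum>c\<in>B. card {y \<in> Y. c \<oplus> y \<in> B})" if "finite Y" for Y
    using sum.swap_restrict[OF that fin(1), of "\<lambda>_ _. 1::nat" "\<lambda>y b. b \<oplus> y \<in> B"]
    by (simp add: ret_def)
  have "(\<Sum>y\<in>carrier G. ret y) = (\<Sum>c\<in>B. card B)"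
    unfolding count[OF assms(1)] using assms(2)
    by (intro sum.cong refl card_shift_preimage) auto
  then have total: "(\<Sum>y\<in>carrier G. real (ret y)) = real (card B) * card B"
    by (simp flip: of_nat_sum of_nat_mult)
  have H: "H \<subseteq> carrier G" by (auto simp: H_def almost_period_def)
  have total_H: "(\<Sum>y\<in>H. real (ret y)) \<le> real (card B) * card B"
    unfolding total[symmetric] using assms(1) H by (intro sum_mono2) auto

  have "(\<Sum>y\<in>H. (1 - \<tau>) * card B) \<le> (\<Sum>y\<in>H. real (ret y))"
  proof (rule sum_mono)
    fix y assume "y \<in> H"
    then show "(1 - \<tau>) * card B \<le> ret y"
      using ret_compl[of y] by (simp add: H_def almost_period_def algebra_simps flip: of_nat_add)
  qed
  with total_H have "((1 - \<tau>) * card H) * card B \<le> real (card B) * card B"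
    by (simp add: mult_ac)
  with cardB show "(1 - \<tau>) * card H \<le> card B" by simp

  show "\<exists>c\<in>B. (1 - \<kappa>) * card B \<le> card {h \<in> H. c \<oplus> h \<in> B}"
  proof (rule ccontr)
    assume "\<not> ?thesis"
    then have "(\<Sum>c\<in>B. real (card {h \<in> H. c \<oplus> h \<in> B})) < (\<Sum>c\<in>B. (1 - \<kappa>) * card B)"
      using fin assms(3) by (intro sum_strict_mono) auto
    then have small: "(\<Sum>y\<in>H. real (ret y)) < card B * ((1 - \<kappa>) * card B)"
      using count[OF fin(2)] by (simp flip: of_nat_sum)
    have "(\<Sum>y\<in>carrier G - H. real (ret y)) \<le> (\<Sum>y\<in>carrier G - H. \<delta> * card B)"
      using dichotomy by (intro sum_mono) (auto simp: H_def almost_period_def ret_def)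
    also have "\<dots> \<le> (\<Sum>y\<in>carrier G. \<delta> * card B)"
      using assms(1,5) by (intro sum_mono2) auto
    also have "\<dots> = (\<delta> * card (carrier G)) * card B" by (simp add: mult_ac)
    also have "\<dots> \<le> (\<kappa> * card B) * card B"
      using assms(4) by (intro mult_right_mono) auto
    finally have "(\<Sum>y\<in>carrier G - H. real (ret y)) \<le> (\<kappa> * card B) * card B" .
    moreover have "(\<Sum>y\<in>carrier G. real (ret y))
        = (\<Sum>y\<in>carrier G - H. real (ret y)) + (\<Sum>y\<in>H. real (ret y))"
      using assms(1) H by (rule sum.subset_diff[rotated])
    ultimately show False
      using small total by (simp add: algebra_simps)
  qed
qed

text \<open>The membership of \<open>b \<oplus> y\<close> in the cell is decided by \<open>length L\<close> conditions on \<open>b\<close>, each of them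
again given by a translate of \<open>A\<close>, so each fails almost always or holds almost always on \<open>B\<close>.\<close>

lemma good_cell_dichotomy:
  fixes A :: "'a set" and L :: "('a \<times> bool) list" and \<delta> :: real
  defines "R \<equiv> \<lambda>x b. x \<oplus> b \<in> A"
  defines "B \<equiv> cell R (carrier G) L"
  assumes "finite (carrier G)" and "fst ` set L \<subseteq> carrier G" and y: "y \<in> carrier G" and "0 \<le> \<delta>"
    and good: "\<And>x. x \<in> carrier G \<Longrightarrow> card {b \<in> B. R x b} \<le> \<delta> * card B \<or>
                     card {b \<in> B. \<not> R x b} \<le> \<delta> * card B"
  shows "card {b \<in> B. b \<oplus> y \<in> B} \<le> \<delta> * card B \<or>
         card {b \<in> B. b \<oplus> y \<notin> B} \<le> length L * \<delta> * card B"
proof -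
  have B: "B \<subseteq> carrier G" unfolding B_def by (rule cell_subset)
  then have fin: "finite B" using assms(3) by (rule finite_subset)
  have shift: "R x (b \<oplus> y) \<longleftrightarrow> R (x \<oplus> y) b" if "x \<in> carrier G" "b \<in> B" for x b
  proof -
    have "b \<in> carrier G" using that B by auto
    with that y have "x \<oplus> (b \<oplus> y) = x \<oplus> y \<oplus> b" by (simp add: a_ac)
    then show ?thesis by (simp add: R_def)
  qed
  have mem: "b \<oplus> y \<in> B \<longleftrightarrow> (\<forall>(x, s)\<in>set L. R (x \<oplus> y) b = s)" if "b \<in> B" for b
    using that y B assms(4) shift[OF _ that] by (fastforce simp: B_def cell_def)
  show ?thesis
  proof (cases "\<exists>(x, s)\<in>set L. card {b \<in> B. R (x \<oplus> y) b = s} \<le> \<delta> * card B")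
    case True
    then obtain x s where xs: "(x, s) \<in> set L" "card {b \<in> B. R (x \<oplus> y) b = s} \<le> \<delta> * card B"
      by auto
    have "card {b \<in> B. b \<oplus> y \<in> B} \<le> card {b \<in> B. R (x \<oplus> y) b = s}"
      using fin xs(1) mem by (intro card_mono) auto
    with xs(2) show ?thesis by auto
  next
    case False
    let ?D = "\<lambda>(x, s). {b \<in> B. R (x \<oplus> y) b \<noteq> s}"
    have D: "card (?D q) \<le> \<delta> * card B" if "q \<in> set L" for q
    proof -
      obtain x s where q: "q = (x, s)" by (cases q)
      have "x \<oplus> y \<in> carrier G" using that q y assms(4) by auto
      from good[OF this] False that show ?thesis by (cases s) (auto simp: q)
    qed
    have "card {b \<in> B. b \<oplus> y \<notin> B} \<le> card (\<Union>q\<in>set L. ?D q)"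
      using fin mem by (intro card_mono) auto
    also have "\<dots> \<le> (\<Sum>q\<in>set L. card (?D q))"
      by (rule card_UN_le) simp
    finally have "real (card {b \<in> B. b \<oplus> y \<notin> B}) \<le> (\<Sum>q\<in>set L. real (card (?D q)))"
      by (simp flip: of_nat_sum)
    also have "\<dots> \<le> (\<Sum>q\<in>set L. \<delta> * card B)"
      by (intro sum_mono D)
    also have "\<dots> = card (set L) * (\<delta> * card B)" by simp
    also have "\<dots> \<le> length L * (\<delta> * card B)"
      using \<open>0 \<le> \<delta>\<close> card_length[of L] by (intro mult_right_mono) auto
    finally show ?thesis by (simp add: mult_ac)
  qed
qed

text \<open>If \<open>c \<oplus> H\<close> is mostly covered by \<open>B\<close> and \<open>P\<close> is rare on \<open>B\<close>, then \<open>P\<close> is rare on \<open>c \<oplus> H\<close>.\<close>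

lemma coset_count_le:
  assumes "finite (carrier G)" "B \<subseteq> carrier G" "H \<subseteq> carrier G" "c \<in> carrier G"
  shows "card {h \<in> H. P (c \<oplus> h)} + card {h \<in> H. c \<oplus> h \<in> B} \<le> card H + card {b \<in> B. P b}"
proof -
  have fin: "finite H" "finite B" using assms by (auto intro: finite_subset)
  have "card {h \<in> H. c \<oplus> h \<in> B \<and> P (c \<oplus> h)} = card ((\<lambda>h. c \<oplus> h) ` {h \<in> H. c \<oplus> h \<in> B \<and> P (c \<oplus> h)})"
    using assms by (intro card_image[symmetric] inj_onI) (auto simp: subset_iff)
  also have "\<dots> \<le> card {b \<in> B. P b}"
    using fin by (intro card_mono) auto
  finally have *: "card {h \<in> H. c \<oplus> h \<in> B \<and> P (c \<oplus> h)} \<le> card {b \<in> B. P b}" .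
  have "card {h \<in> H. P (c \<oplus> h)} + card {h \<in> H. c \<oplus> h \<in> B}
      = card ({h \<in> H. P (c \<oplus> h)} \<union> {h \<in> H. c \<oplus> h \<in> B})
        + card ({h \<in> H. P (c \<oplus> h)} \<inter> {h \<in> H. c \<oplus> h \<in> B})"
    using fin by (intro card_Un_Int) auto
  also have "\<dots> \<le> card H + card {h \<in> H. c \<oplus> h \<in> B \<and> P (c \<oplus> h)}"
    using fin by (intro add_mono card_mono) auto
  finally show ?thesis using * by linarith
qed

text \<open>The conclusion calls \<open>H\<close> a subgroup by asking for \<open>\<zero>\<close> and sums only: in a finite group negatives
are multiples.\<close>

theorem no_tree_imp_good_subgroup:
  fixes \<epsilon> :: real
  assumes fin: "finite (carrier G)" and "0 < \<epsilon>" "\<epsilon> < 1"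
    and no_tree: "\<not> has_tree (\<lambda>x b. x \<oplus> b \<in> A) d (carrier G) (carrier G)"
  shows "\<exists>H \<subseteq> carrier G. \<zero> \<in> H \<and> (\<forall>y\<in>H. \<forall>z\<in>H. y \<oplus> z \<in> H) \<and>
           (\<epsilon> / (2 * real d + 4)) ^ (2 ^ d) * card (carrier G) \<le> card H \<and>
           (\<forall>g\<in>carrier G. card {h \<in> H. g \<oplus> h \<in> A} \<le> \<epsilon> * card H \<or>
                            card {h \<in> H. g \<oplus> h \<notin> A} \<le> \<epsilon> * card H)"
proof -
  define R where "R = (\<lambda>x b. x \<oplus> b \<in> A)"
  (* The errors made below are kappa + delta + tau <= (d + 2) * kappa on the coset, and
     delta + 2 * tau <= (2 * d + 1) * kappa < 1 is needed for H to be closed under addition. *)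
  define \<kappa> where "\<kappa> = \<epsilon> / (2 * real d + 4)"
  have \<kappa>: "0 < \<kappa>" "\<kappa> < 1" "(2 * real d + 4) * \<kappa> = \<epsilon>"
    using assms(2,3) by (auto simp: \<kappa>_def field_simps)
  have cell_Nil: "cell R (carrier G) [] = carrier G" by (auto simp: cell_def)
  have "\<not> has_tree R d (carrier G) (cell R (carrier G) [])"
    using no_tree by (simp add: cell_Nil flip: R_def)
  from exists_good_cell[OF fin \<kappa>(1) this] obtain L where
    L: "length L \<le> d" "fst ` set L \<subseteq> carrier G"
      "\<kappa> ^ (2 ^ length L - 1) * card (carrier G) \<le> card (cell R (carrier G) L)" and
    good0: "\<And>x. x \<in> carrier G \<Longrightarrow>
        card {b \<in> cell R (carrier G) L. R x b} \<le> \<kappa> ^ 2 ^ length L * card (cell R (carrier G) L) \<or>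
        card {b \<in> cell R (carrier G) L. \<not> R x b} \<le> \<kappa> ^ 2 ^ length L * card (cell R (carrier G) L)"
    unfolding cell_Nil by auto
  define B where "B = cell R (carrier G) L"
  define \<delta> where "\<delta> = \<kappa> ^ (2 ^ length L)"
  define \<tau> where "\<tau> = d * \<delta>"
  define H where "H = almost_period B \<tau>"
  have good: "card {b \<in> B. R x b} \<le> \<delta> * card B \<or> card {b \<in> B. \<not> R x b} \<le> \<delta> * card B"
    if "x \<in> carrier G" for x
    using good0[OF that] by (simp add: B_def \<delta>_def)
  have B: "B \<subseteq> carrier G" unfolding B_def by (rule cell_subset)
  have finB: "finite B" using B fin by (rule finite_subset)
  have H: "H \<subseteq> carrier G" by (auto simp: H_def almost_period_def)

  have "0 < \<kappa> ^ (2 ^ length L - 1) * card (carrier G)"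
    using \<kappa>(1) fin zero_closed by (intro mult_pos_pos) (auto simp: card_gt_0_iff)
  with L(3) have cardB: "real (card B) > 0" unfolding B_def by linarith
  then have "B \<noteq> {}" by auto
  have \<delta>: "0 < \<delta>" "\<delta> \<le> \<kappa>"
    using \<kappa> power_decreasing[of 1 "2 ^ length L" \<kappa>] by (auto simp: \<delta>_def)
  have \<delta>_eq: "\<delta> = \<kappa> * \<kappa> ^ (2 ^ length L - 1)"
    unfolding \<delta>_def by (simp flip: power_Suc)
  have dens: "\<delta> * card (carrier G) \<le> \<kappa> * card B"
    using mult_left_mono[OF L(3), of \<kappa>] \<kappa>(1) by (simp add: \<delta>_eq B_def mult_ac)
  have \<tau>: "0 \<le> \<tau>" "\<tau> \<le> d * \<kappa>"
    using \<delta> by (auto simp: \<tau>_def intro: mult_left_mono)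
  have d\<kappa>: "2 * (d * \<kappa>) + 4 * \<kappa> = \<epsilon>" using \<kappa>(3) by (simp add: algebra_simps)

  have small: "\<delta> + 2 * \<tau> < 1"
    using d\<kappa> \<delta> \<tau> \<kappa>(1) assms(3) by linarith

  have dichotomy: "card {b \<in> B. b \<oplus> y \<in> B} \<le> \<delta> * card B \<or> card {b \<in> B. b \<oplus> y \<notin> B} \<le> \<tau> * card B"
    if "y \<in> carrier G" for y
  proof -
    have "card {b \<in> B. b \<oplus> y \<in> B} \<le> \<delta> * card B \<or>
          card {b \<in> B. b \<oplus> y \<notin> B} \<le> length L * \<delta> * card B"
      unfolding B_def R_def
      by (rule good_cell_dichotomy) (use fin L(2) that \<delta> good in \<open>auto simp: B_def R_def\<close>)
    moreover have "length L * \<delta> * card B \<le> \<tau> * card B"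
      unfolding \<tau>_def using L(1) \<delta> by (intro mult_right_mono) auto
    ultimately show ?thesis by linarith
  qed

  have closed: "y \<oplus> z \<in> H" if "y \<in> H" "z \<in> H" for y z
    using almost_period_add_closed[OF finB B \<open>B \<noteq> {}\<close> small dichotomy] that
    unfolding H_def by blast
  have no_exit: "{b \<in> B. b \<oplus> \<zero> \<notin> B} = {}" using B by (auto simp: subset_iff)
  have zero: "\<zero> \<in> H"
    unfolding H_def almost_period_def mem_Collect_eq no_exit using \<tau> by simp

  from indivisible_set_near_coset[OF fin B \<open>B \<noteq> {}\<close> dens _ dichotomy] \<delta>
  obtain c where upper: "(1 - \<tau>) * card H \<le> card B"
    and c: "c \<in> B" "(1 - \<kappa>) * card B \<le> card {h \<in> H. c \<oplus> h \<in> B}"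
    unfolding H_def by auto
  have cG: "c \<in> carrier G" using c(1) B by auto
  have finH: "finite H" using H fin by (rule finite_subset)

  have "\<kappa> ^ (2 ^ d) * card (carrier G) \<le> \<delta> * card (carrier G)"
    unfolding \<delta>_def using \<kappa> L(1)
    by (intro mult_right_mono power_decreasing power_increasing) simp_all
  also have "\<dots> \<le> \<kappa> * card B" by (rule dens)
  also have "\<dots> \<le> (1 - \<kappa>) * card B"
  proof (rule mult_right_mono)
    have "0 \<le> d * \<kappa>" using \<kappa>(1) by simp
    then show "\<kappa> \<le> 1 - \<kappa>" using d\<kappa> assms(3) by linarith
  qed simp
  also have "\<dots> \<le> card {h \<in> H. c \<oplus> h \<in> B}" by (rule c(2))
  also have "\<dots> \<le> card H" using finH by (intro of_nat_mono card_mono) auto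
  finally have index: "\<kappa> ^ (2 ^ d) * card (carrier G) \<le> card H" .

  have transfer: "card {h \<in> H. P (c \<oplus> h)} \<le> \<epsilon> * card H"
    if "card {b \<in> B. P b} \<le> \<delta> * card B" for P
  proof -
    have "real (card {h \<in> H. P (c \<oplus> h)}) + card {h \<in> H. c \<oplus> h \<in> B} \<le> real (card H) + card {b \<in> B. P b}"
      using coset_count_le[OF fin B H cG, of P] by (simp flip: of_nat_add)
    with that c(2) have "card {h \<in> H. P (c \<oplus> h)} \<le> card H - (1 - \<kappa> - \<delta>) * card B"
      by (simp add: algebra_simps)
    also have "\<dots> \<le> card H - (1 - \<kappa> - \<delta>) * ((1 - \<tau>) * card H)"
    proof (intro diff_left_mono mult_left_mono upper)
      have "0 \<le> d * \<kappa>" using \<kappa>(1) by simp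
      then show "0 \<le> 1 - \<kappa> - \<delta>" using d\<kappa> \<delta> \<kappa>(1) assms(3) by linarith
    qed
    also have "\<dots> = (\<kappa> + \<delta> + \<tau> - (\<kappa> + \<delta>) * \<tau>) * card H"
      by (simp add: algebra_simps)
    also have "\<dots> \<le> \<epsilon> * card H"
    proof (rule mult_right_mono)
      have "0 \<le> d * \<kappa>" "0 \<le> (\<kappa> + \<delta>) * \<tau>" using \<kappa>(1) \<delta> \<tau> by simp_all
      then show "\<kappa> + \<delta> + \<tau> - (\<kappa> + \<delta>) * \<tau> \<le> \<epsilon>" using d\<kappa> \<delta> \<tau> \<kappa>(1) by linarith
    qed simp
    finally show ?thesis .
  qed
  have coset_good:
    "card {h \<in> H. g \<oplus> h \<in> A} \<le> \<epsilon> * card H \<or> card {h \<in> H. g \<oplus> h \<notin> A} \<le> \<epsilon> * card H"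
    if g: "g \<in> carrier G" for g
  proof -
    have "(g \<ominus> c) \<oplus> (c \<oplus> h) = g \<oplus> h" if "h \<in> H" for h
      using that H g cG by (auto simp: minus_eq a_assoc r_neg1 subset_iff)
    then have "{h \<in> H. R (g \<ominus> c) (c \<oplus> h)} = {h \<in> H. g \<oplus> h \<in> A}"
      "{h \<in> H. \<not> R (g \<ominus> c) (c \<oplus> h)} = {h \<in> H. g \<oplus> h \<notin> A}"
      by (auto simp: R_def)
    moreover have "g \<ominus> c \<in> carrier G" using g cG by simp
    ultimately show ?thesis
      using good[of "g \<ominus> c"] transfer[of "R (g \<ominus> c)"] transfer[of "\<lambda>b. \<not> R (g \<ominus> c) b"] by auto
  qed
  show ?thesis
    by (intro exI[of _ H] conjI ballI H zero closed index[unfolded \<kappa>_def] coset_good)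
qed

end

section \<open>Codimension and density in a finite vector space\<close>

lemma (in vectorspace) card_carrier_eq_power_dim:
  assumes "finite (carrier V)"
  shows "card (carrier V) = card (carrier K) ^ dim"
proof -
  have "span (carrier V) = carrier V"
    by (metis in_own_span span_is_subset2 subset_antisym subset_refl)
  then have fd: "fin_dim"
    unfolding fin_dim_def using assms by (intro exI[of _ "carrier V"]) auto
  then obtain E where E: "finite E" "basis E"
    using finite_basis_exists by auto
  then have EV: "E \<subseteq> carrier V" by (simp add: basis_def)
  have unique: "\<forall>v. v \<in> carrier V \<longrightarrow> (\<exists>!a. a \<in> E \<rightarrow>\<^sub>E carrier K \<and> lincomb a E = v)"
    using E basis_criterion[OF E(1) EV] by blast
  have closed: "lincomb a E \<in> carrier V" if "a \<in> E \<rightarrow>\<^sub>E carrier K" for a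
    using that EV by (intro lincomb_closed) auto
  have "bij_betw (\<lambda>a. lincomb a E) (E \<rightarrow>\<^sub>E carrier K) (carrier V)"
    unfolding bij_betw_def inj_on_def
  proof (intro conjI ballI impI subset_antisym subsetI)
    fix v assume "v \<in> carrier V"
    with unique obtain a where "a \<in> E \<rightarrow>\<^sub>E carrier K" "lincomb a E = v" by blast
    then show "v \<in> (\<lambda>a. lincomb a E) ` (E \<rightarrow>\<^sub>E carrier K)" by blast
  qed (use unique closed in blast)+
  then have "card (carrier V) = card (E \<rightarrow>\<^sub>E carrier K)"
    by (simp add: bij_betw_same_card)
  also have "\<dots> = card (carrier K) ^ card E"
    using E(1) by (simp add: card_PiE)
  also have "card E = dim" using dim_basis[OF E] by simp
  finally show ?thesis .
qed

text \<open>A subspace of codimension \<open>r\<close> has density \<open>q ^ (- r)\<close> with \<open>q \<ge> 2\<close>, and \<open>r < 2 ^ r\<close>. Giving away the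
logarithm here keeps the bound a power of the density, which is all that is needed.\<close>

lemma codim_le_inverse_density:
  fixes \<beta> :: real
  assumes "vectorspace K V" and "subspace K H V"
    and "finite (carrier V)" "finite (carrier K)"
    and "0 < \<beta>" "\<beta> * card (carrier V) \<le> card H"
  shows "codim K V H \<le> 1 / \<beta>"
proof -
  interpret V: vectorspace K V by fact
  interpret H: vectorspace K "V\<lparr>carrier := H\<rparr>"
    by (rule V.subspace_is_vs[OF assms(2)])
  have "H \<subseteq> carrier V"
    using assms(2) by (simp add: subspace_def submodule_def)
  then have finH: "finite (carrier (V\<lparr>carrier := H\<rparr>))"
    using assms(3) by (auto intro: finite_subset)
  define q where "q = card (carrier K)"
  have "card {\<zero>\<^bsub>K\<^esub>, \<one>\<^bsub>K\<^esub>} \<le> q"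
    unfolding q_def using assms(4) by (intro card_mono) auto
  then have q: "2 \<le> q" by simp
  have cards: "card (carrier V) = q ^ V.dim" "card H = q ^ H.dim"
    using V.card_carrier_eq_power_dim[OF assms(3)] H.card_carrier_eq_power_dim[OF finH]
    by (simp_all add: q_def)
  show ?thesis
  proof (cases "V.dim \<le> H.dim")
    case True
    then have "real_of_int (codim K V H) \<le> 0" by (simp add: codim_def)
    also have "\<dots> \<le> 1 / \<beta>" using assms(5) by simp
    finally show ?thesis .
  next
    case False
    define r where "r = V.dim - H.dim"
    have "V.dim = r + H.dim" using False by (simp add: r_def)
    then have "(\<beta> * real q ^ r) * real q ^ H.dim \<le> 1 * real q ^ H.dim"
      using assms(6) cards by (simp add: power_add mult_ac)
    then have "\<beta> * real q ^ r \<le> 1"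
      using q by (subst (asm) mult_le_cancel_right) auto
    then have "real q ^ r \<le> 1 / \<beta>"
      using assms(5) by (simp add: field_simps)
    moreover have "real r < real q ^ r"
    proof -
      have "r < 2 ^ r" by (rule less_exp)
      also have "\<dots> \<le> q ^ r" using q by (rule power_mono) simp
      finally show ?thesis by (simp flip: of_nat_power)
    qed
    moreover have "real_of_int (codim K V H) = real r"
      using False by (simp add: codim_def r_def)
    ultimately show ?thesis by linarith
  qed
qed

text \<open>Over a prime field every scalar is a sum of ones.\<close>

lemma subspace_Fp_if_add_closed:
  assumes "prime p" and "vectorspace (Fp p) V"
    and "H \<subseteq> carrier V" "\<zero>\<^bsub>V\<^esub> \<in> H" "\<And>y z. y \<in> H \<Longrightarrow> z \<in> H \<Longrightarrow> y \<oplus>\<^bsub>V\<^esub> z \<in> H"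
  shows "subspace (Fp p) H V"
proof -
  interpret F: residues_prime p "Fp p"
    by unfold_locales (use assms(1) in simp_all)
  interpret V: vectorspace "Fp p" V by fact
  have multiple: "int n \<odot>\<^bsub>V\<^esub> v \<in> H" if "n < p" "v \<in> H" for n v
    using that(1)
  proof (induction n)
    case 0
    have "\<zero>\<^bsub>Fp p\<^esub> \<odot>\<^bsub>V\<^esub> v = \<zero>\<^bsub>V\<^esub>" using that(2) assms(3) by (intro V.lmult_0) auto
    then show ?case using assms(4) by (simp add: F.res_zero_eq)
  next
    case (Suc n)
    have "int (Suc n) = int n \<oplus>\<^bsub>Fp p\<^esub> \<one>\<^bsub>Fp p\<^esub>"
      using Suc.prems by (simp add: F.res_add_eq F.res_one_eq)
    moreover have "int n \<in> carrier (Fp p)"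
      using Suc.prems by (simp add: F.res_carrier_eq)
    ultimately have "int (Suc n) \<odot>\<^bsub>V\<^esub> v = int n \<odot>\<^bsub>V\<^esub> v \<oplus>\<^bsub>V\<^esub> v"
      using that(2) assms(3) V.smult_l_distr[of "int n" "\<one>\<^bsub>Fp p\<^esub>" v]
      by (auto simp: V.smult_one)
    then show ?case using Suc assms(5) that(2) by simp
  qed
  show ?thesis
  proof (intro subspace.intro submodule.intro assms V.module_axioms)
    fix c v assume "c \<in> carrier (Fp p)" "v \<in> H"
    then show "c \<odot>\<^bsub>V\<^esub> v \<in> H"
      using multiple[of "nat c" v] by (auto simp: F.res_carrier_eq)
  qed
qed

section \<open>Stable sets in the space of vectors over a prime field\<close>

lemma finite_Fp_space:
  assumes "prime p"
  shows "finite (carrier (Fp_space p n))"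
proof -
  interpret F: residues_prime p "Fp p"
    by unfold_locales (use assms in simp_all)
  show ?thesis
    unfolding F.func_space_def by (auto intro: finite_PiE)
qed

lemma (in abelian_group) translate_mem_iff:
  assumes "A \<subseteq> carrier G" "g \<in> carrier G" "h \<in> carrier G"
  shows "h \<in> translate G A g \<longleftrightarrow> g \<oplus> h \<in> A"
proof
  assume "h \<in> translate G A g"
  then obtain a where "a \<in> A" "h = a \<ominus> g" by (auto simp: translate_def)
  with assms show "g \<oplus> h \<in> A" by (auto simp: minus_eq a_ac r_neg1 r_neg subset_iff)
next
  assume "g \<oplus> h \<in> A"
  moreover have "h = (g \<oplus> h) \<ominus> g" using assms by (subst a_comm[of g h]) (simp_all add: minus_eq a_assoc r_neg)
  ultimately show "h \<in> translate G A g" by (auto simp: translate_def)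
qed

theorem theorem1:
  "\<forall>k\<ge>(2::nat). \<exists>C>(0::real). \<forall>\<epsilon>::real. 0 < \<epsilon> \<and> \<epsilon> < 1 \<longrightarrow> (\<forall>p::nat. prime p \<longrightarrow>
     (\<exists>n0::nat. \<forall>n\<ge>n0. \<forall>A. A \<subseteq> carrier (Fp_space p n) \<and> k_stable (Fp_space p n) k A \<longrightarrow>
        (\<exists>H. subspace (Fp p) H (Fp_space p n) \<and>
             real_of_int (codim (Fp p) (Fp_space p n) H) \<le> C * \<epsilon> powr (- C) \<and>
             (\<forall>g\<in>carrier (Fp_space p n).
                real (card (translate (Fp_space p n) A g \<inter> H)) \<le> \<epsilon> * real (card H) \<or>
                real (card (H - translate (Fp_space p n) A g)) \<le> \<epsilon> * real (card H)))))"
proof (intro allI impI)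
  fix k :: nat assume "2 \<le> k"
  define d :: nat where "d = 2 ^ (k + 1) - 2"
  define C where "C = (2 * real d + 4) ^ (2 ^ d)"
  have C: "2 ^ d \<le> C"
  proof -
    have "(2::real) ^ d \<le> 2 ^ (2 ^ d)" by (intro power_increasing) (simp_all add: less_imp_le)
    also have "\<dots> \<le> C" unfolding C_def by (rule power_mono) simp_all
    finally show ?thesis .
  qed
  show "\<exists>C>(0::real). \<forall>\<epsilon>::real. 0 < \<epsilon> \<and> \<epsilon> < 1 \<longrightarrow> (\<forall>p::nat. prime p \<longrightarrow>
     (\<exists>n0::nat. \<forall>n\<ge>n0. \<forall>A. A \<subseteq> carrier (Fp_space p n) \<and> k_stable (Fp_space p n) k A \<longrightarrow>
        (\<exists>H. subspace (Fp p) H (Fp_space p n) \<and>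
             real_of_int (codim (Fp p) (Fp_space p n) H) \<le> C * \<epsilon> powr (- C) \<and>
             (\<forall>g\<in>carrier (Fp_space p n).
                real (card (translate (Fp_space p n) A g \<inter> H)) \<le> \<epsilon> * real (card H) \<or>
                real (card (H - translate (Fp_space p n) A g)) \<le> \<epsilon> * real (card H)))))"
  proof (intro exI[of _ C] conjI allI impI exI[of _ 0])
    show "0 < C" using C by (rule less_le_trans[rotated]) simp
    fix \<epsilon> :: real and p n :: nat and A
    assume \<epsilon>: "0 < \<epsilon> \<and> \<epsilon> < 1" and p: "prime p"
      and A: "A \<subseteq> carrier (Fp_space p n) \<and> k_stable (Fp_space p n) k A"
    interpret F: residues_prime p "Fp p"
      by unfold_locales (use p in simp_all)
    interpret V: vectorspace "Fp p" "Fp_space p n"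
      by (rule vectorspace_Fp_space[OF p])
    define V where "V = Fp_space p n"
    define \<beta> where "\<beta> = (\<epsilon> / (2 * real d + 4)) ^ (2 ^ d)"
    have fin: "finite (carrier V)" unfolding V_def by (rule finite_Fp_space[OF p])
    have VG: "abelian_group V" unfolding V_def by (rule V.abelian_group_axioms)
    have "\<not> has_tree (\<lambda>x b. x \<oplus>\<^bsub>V\<^esub> b \<in> A) d (carrier V) (carrier V)"
      unfolding d_def V_def using A by (intro k_stable_imp_no_tree) simp
    with VG fin have "\<exists>H \<subseteq> carrier V. \<zero>\<^bsub>V\<^esub> \<in> H \<and> (\<forall>y\<in>H. \<forall>z\<in>H. y \<oplus>\<^bsub>V\<^esub> z \<in> H) \<and>
        \<beta> * card (carrier V) \<le> card H \<and>
        (\<forall>g\<in>carrier V. card {h \<in> H. g \<oplus>\<^bsub>V\<^esub> h \<in> A} \<le> \<epsilon> * card H \<or>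
                         card {h \<in> H. g \<oplus>\<^bsub>V\<^esub> h \<notin> A} \<le> \<epsilon> * card H)"
      unfolding \<beta>_def using \<epsilon> by (intro abelian_group.no_tree_imp_good_subgroup) simp_all
    then obtain H where H: "H \<subseteq> carrier V" "\<zero>\<^bsub>V\<^esub> \<in> H" "\<And>y z. y \<in> H \<Longrightarrow> z \<in> H \<Longrightarrow> y \<oplus>\<^bsub>V\<^esub> z \<in> H"
        "\<beta> * card (carrier V) \<le> card H" and
      good: "\<And>g. g \<in> carrier V \<Longrightarrow> card {h \<in> H. g \<oplus>\<^bsub>V\<^esub> h \<in> A} \<le> \<epsilon> * card H \<or>
                       card {h \<in> H. g \<oplus>\<^bsub>V\<^esub> h \<notin> A} \<le> \<epsilon> * card H"
      by blast
    have sub: "subspace (Fp p) H V"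
      using p vectorspace_Fp_space[OF p] H unfolding V_def by (intro subspace_Fp_if_add_closed) auto
    have "codim (Fp p) V H \<le> 1 / \<beta>"
      using vectorspace_Fp_space[OF p] sub fin H(4) \<epsilon> unfolding V_def \<beta>_def
      by (intro codim_le_inverse_density) (auto intro: F.finite)
    also have "1 / \<beta> = C * \<epsilon> powr (- (2 ^ d))"
    proof -
      have "\<epsilon> powr (2 ^ d) = \<epsilon> ^ (2 ^ d)"
        using \<epsilon> powr_realpow[of \<epsilon> "2 ^ d"] by simp
      then show ?thesis
        by (simp add: \<beta>_def C_def power_divide powr_minus field_simps)
    qed
    also have "\<dots> \<le> C * \<epsilon> powr (- C)"
      using \<epsilon> C by (intro mult_left_mono powr_mono') (auto simp: C_def)
    finally have codim: "codim (Fp p) V H \<le> C * \<epsilon> powr (- C)" .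
    have "card (translate V A g \<inter> H) \<le> \<epsilon> * card H \<or> card (H - translate V A g) \<le> \<epsilon> * card H"
      if g: "g \<in> carrier V" for g
    proof -
      have "h \<in> translate V A g \<longleftrightarrow> g \<oplus>\<^bsub>V\<^esub> h \<in> A" if "h \<in> H" for h
        using abelian_group.translate_mem_iff[OF VG] A g that H(1) by (auto simp: V_def)
      then have "translate V A g \<inter> H = {h \<in> H. g \<oplus>\<^bsub>V\<^esub> h \<in> A}"
        "H - translate V A g = {h \<in> H. g \<oplus>\<^bsub>V\<^esub> h \<notin> A}"
        by auto
      with good[OF g] show ?thesis by simp
    qed
    with sub codim show "\<exists>H. subspace (Fp p) H (Fp_space p n) \<and>
             real_of_int (codim (Fp p) (Fp_space p n) H) \<le> C * \<epsilon> powr (- C) \<and>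
             (\<forall>g\<in>carrier (Fp_space p n).
                real (card (translate (Fp_space p n) A g \<inter> H)) \<le> \<epsilon> * real (card H) \<or>
                real (card (H - translate (Fp_space p n) A g)) \<le> \<epsilon> * real (card H))"
      unfolding V_def by blast
  qed
qed

end
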